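(* Let $\mathbb{A}$ be a reduced medial algebra of dimension at least $2$ over a field of characteristic not $2,3$. If $c_1$ is a semi-simple nonzero idempotent, then for any nonzero idempotent $c_2$ the idempotent $c_1c_2$ is also semi-simple and $\operatorname{spec}(c_1)=\operatorname{spec}(c_1c_2)$.
   Context: All algebras commutative, possibly nonassociative, finite-dimensional. Medial: $(xy)(zw)=(xz)(yw)$ identically. Reduced: $\ker L_c=0$ for every nonzero idempotent $c$, where $L_c:x\mapsto cx$. $\operatorname{spec}(c)$ is the multiset of roots of the characteristic polynomial of $L_c$. An idempotent $c$ is semi-simple if $\mathbb{A}$ is the direct sum of the eigenspaces of $L_c$. *)

theory Defs
  imports "HOL-Analysis.Analysis" "HOL-Computational_Algebra.Polynomial"
begin

text \<open>A finite-dimensional commutative (possibly nonassociative) algebra over a field 'k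
  is modelled on the coordinate space 'k^'n (dimension CARD('n)) with a multiplication
  mul that is bilinear.\<close>

definition alg_bilinear :: "('k::field^'n \<Rightarrow> 'k^'n \<Rightarrow> 'k^'n) \<Rightarrow> bool" where
  "alg_bilinear mul \<longleftrightarrow>
     (\<forall>x. Vector_Spaces.linear (*s) (*s) (mul x)) \<and>
     (\<forall>y. Vector_Spaces.linear (*s) (*s) (\<lambda>x. mul x y))"

definition alg_commutative :: "('v \<Rightarrow> 'v \<Rightarrow> 'v) \<Rightarrow> bool" where
  "alg_commutative mul \<longleftrightarrow> (\<forall>x y. mul x y = mul y x)"

definition medial :: "('v \<Rightarrow> 'v \<Rightarrow> 'v) \<Rightarrow> bool" where
  "medial mul \<longleftrightarrow> (\<forall>x y z w. mul (mul x y) (mul z w) = mul (mul x z) (mul y w))"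

definition idempotent :: "('v \<Rightarrow> 'v \<Rightarrow> 'v) \<Rightarrow> 'v \<Rightarrow> bool" where
  "idempotent mul c \<longleftrightarrow> mul c c = c"

text \<open>Reduced: L_c has trivial kernel for every nonzero idempotent c.\<close>
definition reduced_alg :: "('v::zero \<Rightarrow> 'v \<Rightarrow> 'v) \<Rightarrow> bool" where
  "reduced_alg mul \<longleftrightarrow>
     (\<forall>c. c \<noteq> 0 \<and> idempotent mul c \<longrightarrow> (\<forall>x. mul c x = 0 \<longrightarrow> x = 0))"

text \<open>Eigenspace of L_c for the eigenvalue (candidate) lam.\<close>
definition eigenspace_L :: "('k::field^'n \<Rightarrow> 'k^'n \<Rightarrow> 'k^'n) \<Rightarrow> 'k^'n \<Rightarrow> 'k \<Rightarrow> ('k^'n) set" where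
  "eigenspace_L mul c lam = {x. mul c x = lam *s x}"

text \<open>Semi-simple idempotent: the algebra is the (internal) direct sum of the eigenspaces
  of L_c, i.e. every element decomposes uniquely as a finite sum of elements of the
  eigenspaces.\<close>
definition semisimple_idem :: "('k::field^'n \<Rightarrow> 'k^'n \<Rightarrow> 'k^'n) \<Rightarrow> 'k^'n \<Rightarrow> bool" where
  "semisimple_idem mul c \<longleftrightarrow> idempotent mul c \<and>
     (\<forall>x. \<exists>!f. finite {lam. f lam \<noteq> 0} \<and>
                (\<forall>lam. f lam \<in> eigenspace_L mul c lam) \<and>
                x = (\<Sum>lam\<in>{lam. f lam \<noteq> 0}. f lam))"

text \<open>Characteristic polynomial of a square matrix, det(X I - A).\<close>
definition charpoly :: "'k::comm_ring_1^'n^'n \<Rightarrow> 'k poly" where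
  "charpoly A = det (\<chi> i j. (if i = j then [:0, 1:] else 0) - [:A $ i $ j:])"

text \<open>spec(c): multiset of roots of the characteristic polynomial of L_c.\<close>
definition spec :: "('k::field^'n \<Rightarrow> 'k^'n \<Rightarrow> 'k^'n) \<Rightarrow> 'k^'n \<Rightarrow> 'k multiset" where
  "spec mul c = proots (charpoly (matrix (mul c)))"

end

theory Submission
  imports Defs
begin

text \<open>Mediality and the idempotency of \<open>c\<^sub>2\<close> give
  \<open>(c\<^sub>1c\<^sub>2)(c\<^sub>2y) = (c\<^sub>1y)(c\<^sub>2c\<^sub>2) = c\<^sub>2(c\<^sub>1y)\<close>, i.e.
  \<open>L\<^bsub>c\<^sub>1c\<^sub>2\<^esub> L\<^bsub>c\<^sub>2\<^esub> = L\<^bsub>c\<^sub>2\<^esub> L\<^bsub>c\<^sub>1\<^esub>\<close>.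
  Reducedness makes \<open>L\<^bsub>c\<^sub>2\<^esub>\<close> injective, hence invertible, so
  \<open>L\<^bsub>c\<^sub>1c\<^sub>2\<^esub>\<close> is conjugate to \<open>L\<^bsub>c\<^sub>1\<^esub>\<close>; conjugation preserves both the
  eigenspace decomposition and the characteristic polynomial.\<close>

definition const_matrix :: "'k::comm_ring_1^'n^'m \<Rightarrow> 'k poly^'n^'m" where
  "const_matrix A = (\<chi> i j. [:A $ i $ j:])"

lemma const_matrix_mult: "const_matrix (A ** B) = const_matrix A ** const_matrix B"
  by (simp add: const_matrix_def vec_eq_iff matrix_matrix_mult_def sum_to_poly ac_simps)

lemma const_matrix_mat: "const_matrix (mat c) = mat [:c:]"
  by (simp add: const_matrix_def vec_eq_iff mat_def)

lemma mat_matrix_mult_commute: "mat (c::'a::comm_semiring_1) ** A = A ** mat c"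
  by (simp add: mat_def vec_eq_iff matrix_matrix_mult_def if_distrib if_distribR mult.commute
      cong: if_cong)

lemma matrix_diff_rdistrib: "(A - B) ** C = A ** C - B ** (C::'a::ring_1^'p^'n)"
  by (simp add: vec_eq_iff matrix_matrix_mult_def algebra_simps sum_subtractf)

lemma matrix_diff_ldistrib: "C ** (A - B) = C ** A - C ** (B::'a::ring_1^'p^'n)"
  by (simp add: vec_eq_iff matrix_matrix_mult_def algebra_simps sum_subtractf)

lemma charpoly_eq_det: "charpoly A = det (mat [:0, 1:] - const_matrix A)"
  unfolding charpoly_def const_matrix_def mat_def
  by (rule arg_cong[where f = det]) (simp add: vec_eq_iff)

lemma charpoly_similar:
  fixes A C P :: "'k::field^'n^'n"
  assumes intertwine: "C ** P = P ** A" and "invertible P"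
  shows "charpoly C = charpoly A"
proof -
  let ?X = "mat [:0, 1:] :: 'k poly^'n^'n"
  obtain Q where "Q ** P = mat 1"
    using \<open>invertible P\<close> invertible_left_inverse by blast
  then have "det (const_matrix Q) * det (const_matrix P) = 1"
    by (metis det_mul const_matrix_mult const_matrix_mat det_I pCons_one)
  then have det_P: "det (const_matrix P) \<noteq> 0" by auto
  have "(?X - const_matrix C) ** const_matrix P = const_matrix P ** (?X - const_matrix A)"
    by (simp add: matrix_diff_rdistrib matrix_diff_ldistrib mat_matrix_mult_commute
        intertwine flip: const_matrix_mult)
  then have "det (?X - const_matrix C) * det (const_matrix P)
      = det (const_matrix P) * det (?X - const_matrix A)"
    by (metis det_mul)
  with det_P show ?thesis by (simp add: charpoly_eq_det)
qed

lemma charpoly_matrix_conj: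
  fixes L L' T :: "'k::field^'n \<Rightarrow> 'k^'n"
  assumes lin: "Vector_Spaces.linear (*s) (*s) L" "Vector_Spaces.linear (*s) (*s) L'"
      "Vector_Spaces.linear (*s) (*s) T"
    and "inj T" and intertwine: "L' \<circ> T = T \<circ> L"
  shows "charpoly (matrix L') = charpoly (matrix L)"
proof (rule charpoly_similar)
  show "matrix L' ** matrix T = matrix T ** matrix L"
    by (metis intertwine lin matrix_compose_gen)
  obtain S where "Vector_Spaces.linear (*s) (*s) S" "S \<circ> T = id"
    using vec.linear_injective_left_inverse[OF lin(3) \<open>inj T\<close>] by blast
  then have "matrix S ** matrix T = mat 1"
    by (metis lin(3) matrix_compose_gen matrix_id_mat_1)
  then show "invertible (matrix T)"
    using invertible_left_inverse by blast
qed

definition eigen_decomposition :: "('k::field^'n \<Rightarrow> 'k^'n) \<Rightarrow> ('k \<Rightarrow> 'k^'n) \<Rightarrow> 'k^'n \<Rightarrow> bool" where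
  "eigen_decomposition L f x \<longleftrightarrow> finite {lam. f lam \<noteq> 0} \<and>
     (\<forall>lam. L (f lam) = lam *s f lam) \<and> x = (\<Sum>lam\<in>{lam. f lam \<noteq> 0}. f lam)"

definition eigen_decomposable :: "('k::field^'n \<Rightarrow> 'k^'n) \<Rightarrow> bool" where
  "eigen_decomposable L \<longleftrightarrow> (\<forall>x. \<exists>!f. eigen_decomposition L f x)"

lemma semisimple_idem_iff:
  "semisimple_idem mul c \<longleftrightarrow> idempotent mul c \<and> eigen_decomposable (mul c)"
  by (simp add: semisimple_idem_def eigen_decomposable_def eigen_decomposition_def
      eigenspace_L_def)

lemma eigen_decomposition_conj:
  fixes L L' T :: "'k::field^'n \<Rightarrow> 'k^'n"
  assumes lin: "Vector_Spaces.linear (*s) (*s) T" and "inj T"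
    and intertwine: "L' \<circ> T = T \<circ> L"
  shows "eigen_decomposition L' (T \<circ> f) (T x) \<longleftrightarrow> eigen_decomposition L f x"
proof -
  have T_eq_0: "T y = 0 \<longleftrightarrow> y = 0" for y
    by (metis \<open>inj T\<close> lin vec.linear_0 injD)
  have "L' (T y) = lam *s T y \<longleftrightarrow> L y = lam *s y" for lam y
    by (metis intertwine comp_apply \<open>inj T\<close> injD lin vec.linear_scale)
  moreover have "T x = (\<Sum>lam\<in>S. T (f lam)) \<longleftrightarrow> x = (\<Sum>lam\<in>S. f lam)" for S
    by (metis \<open>inj T\<close> injD lin vec.linear_sum)
  ultimately show ?thesis
    by (simp add: eigen_decomposition_def T_eq_0)
qed

lemma eigen_decomposable_conj:
  fixes L L' T :: "'k::field^'n \<Rightarrow> 'k^'n"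
  assumes lin: "Vector_Spaces.linear (*s) (*s) T" and "bij T"
    and intertwine: "L' \<circ> T = T \<circ> L"
    and "eigen_decomposable L"
  shows "eigen_decomposable L'"
  unfolding eigen_decomposable_def
proof
  fix x
  have inj: "inj T" and T_inv: "T (inv T y) = y" for y
    using \<open>bij T\<close> by (auto simp: bij_is_inj bij_is_surj surj_f_inv_f)
  note conj = eigen_decomposition_conj[OF lin inj intertwine]
  obtain f where f: "eigen_decomposition L f (inv T x)"
    and f_unique: "\<And>h. eigen_decomposition L h (inv T x) \<Longrightarrow> h = f"
    using \<open>eigen_decomposable L\<close> unfolding eigen_decomposable_def by blast
  show "\<exists>!g. eigen_decomposition L' g x"
  proof
    show "eigen_decomposition L' (T \<circ> f) x"
      using f conj[of f "inv T x"] by (simp add: T_inv)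
  next
    fix g assume "eigen_decomposition L' g x"
    then have "eigen_decomposition L' (T \<circ> (inv T \<circ> g)) (T (inv T x))"
      by (simp add: T_inv comp_def)
    then have "inv T \<circ> g = f"
      using conj f_unique by blast
    then show "g = T \<circ> f"
      by (metis T_inv comp_apply fun_eq_iff)
  qed
qed

lemma alg_bilinear_linear_mult:
  "alg_bilinear mul \<Longrightarrow> Vector_Spaces.linear (*s) (*s) (mul c)"
  by (simp add: alg_bilinear_def)

lemma reduced_alg_bij_mult:
  assumes "alg_bilinear mul" "reduced_alg mul" "idempotent mul c" "c \<noteq> 0"
  shows "bij (mul c)"
proof -
  note lin = alg_bilinear_linear_mult[OF \<open>alg_bilinear mul\<close>, of c]
  have "mul c x = 0 \<Longrightarrow> x = 0" for x
    using assms unfolding reduced_alg_def by blast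
  then have "inj (mul c)"
    by (simp add: vec.linear_inj_iff_eq_0[OF lin])
  then show ?thesis
    using vec.linear_inj_imp_surj[OF lin] by (simp add: bij_def)
qed

lemma medial_idempotent_mult:
  assumes "medial mul" "idempotent mul c\<^sub>1" "idempotent mul c\<^sub>2"
  shows "idempotent mul (mul c\<^sub>1 c\<^sub>2)"
proof -
  have "mul (mul c\<^sub>1 c\<^sub>2) (mul c\<^sub>1 c\<^sub>2) = mul (mul c\<^sub>1 c\<^sub>1) (mul c\<^sub>2 c\<^sub>2)"
    using \<open>medial mul\<close> unfolding medial_def by blast
  with assms(2,3) show ?thesis
    by (simp add: idempotent_def)
qed

lemma medial_mult_intertwine:
  assumes "alg_commutative mul" "medial mul" "idempotent mul c\<^sub>2"
  shows "mul (mul c\<^sub>1 c\<^sub>2) \<circ> mul c\<^sub>2 = mul c\<^sub>2 \<circ> mul c\<^sub>1"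
proof
  fix y
  have comm: "mul x z = mul z x" for x z
    using \<open>alg_commutative mul\<close> by (simp add: alg_commutative_def)
  have "mul (mul c\<^sub>1 c\<^sub>2) (mul c\<^sub>2 y) = mul (mul c\<^sub>1 c\<^sub>2) (mul y c\<^sub>2)"
    by (simp only: comm[of c\<^sub>2 y])
  also have "\<dots> = mul (mul c\<^sub>1 y) (mul c\<^sub>2 c\<^sub>2)"
    using \<open>medial mul\<close> unfolding medial_def by blast
  also have "\<dots> = mul c\<^sub>2 (mul c\<^sub>1 y)"
    using \<open>idempotent mul c\<^sub>2\<close> unfolding idempotent_def by (simp only: comm)
  finally show "(mul (mul c\<^sub>1 c\<^sub>2) \<circ> mul c\<^sub>2) y = (mul c\<^sub>2 \<circ> mul c\<^sub>1) y"
    by simp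
qed

theorem proposition4p3:
  fixes mul :: "'k::field^'n \<Rightarrow> 'k^'n \<Rightarrow> 'k^'n"
    and c1 c2 :: "'k^'n"
  assumes char2: "(2::'k) \<noteq> 0"
    and char3: "(3::'k) \<noteq> 0"
    and dim: "CARD('n) \<ge> 2"
    and bil: "alg_bilinear mul"
    and comm: "alg_commutative mul"
    and med: "medial mul"
    and red: "reduced_alg mul"
    and c1_ss: "semisimple_idem mul c1"
    and c1_nz: "c1 \<noteq> 0"
    and c2_idem: "idempotent mul c2"
    and c2_nz: "c2 \<noteq> 0"
  shows "semisimple_idem mul (mul c1 c2) \<and> spec mul c1 = spec mul (mul c1 c2)"
proof
  note lin = alg_bilinear_linear_mult[OF bil]
  have bij: "bij (mul c2)"
    using reduced_alg_bij_mult[OF bil red c2_idem c2_nz] .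
  have intertwine: "mul (mul c1 c2) \<circ> mul c2 = mul c2 \<circ> mul c1"
    using medial_mult_intertwine[OF comm med c2_idem] .
  from c1_ss have "idempotent mul c1" "eigen_decomposable (mul c1)"
    by (simp_all add: semisimple_idem_iff)
  then show "semisimple_idem mul (mul c1 c2)"
    using medial_idempotent_mult[OF med _ c2_idem] eigen_decomposable_conj[OF lin bij intertwine]
    by (simp add: semisimple_idem_iff)
  show "spec mul c1 = spec mul (mul c1 c2)"
    using charpoly_matrix_conj[OF lin lin lin bij_is_inj[OF bij] intertwine]
    by (simp add: spec_def)
qed

end
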